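(* Assume $f:\mathbb{R}^N\to\mathbb{R}$ is a smooth convex function that is partially separable of degree $\omega$ ($\omega\ge1$ an integer) and has block Lipschitz gradient with constants $L_1,\dots,L_n>0$, and let $\Psi$ be a block-separable closed convex function. Assume further that $F=f+\Psi$ is strongly convex with $\mu_F(L)>0$, where $L=(L_1,\dots,L_n)$. Let $\{x_k\}_{k\ge0}$ be the sequence generated, from $x_0\in\operatorname{dom}F$, by the fully parallel coordinate descent method described in the context. Then for all $k\ge0$, $$F(x_{k+1})-F^*\le q\,(F(x_k)-F^* ),\qquad\text{where}\qquad q=1-\frac{\mu_F(L)}{\omega+\mu_F(L)-\mu_f(L)}.$$ Moreover, if $0<\epsilon<F(x_0)-F^*$ and $$k\ge\frac1{1-q}\log\left(\frac{F(x_0)-F^*}\epsilon\right),$$ then $F(x_k)-F^*\le\epsilon$.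
   Context: Blocks: $N=\sum_{i=1}^nN_i$; $I=[U_1,\dots,U_n]$ is the columnwise partition of the $N\times N$ identity with $U_i\in\mathbb{R}^{N\times N_i}$, and $x^{(i)}=U_i^Tx$. $\Psi(x)=\sum_{i=1}^n\Psi_i(x^{(i)})$ with $\Psi_i:\mathbb{R}^{N_i}\to\mathbb{R}\cup\{+\infty\}$ convex and closed. $F^*=\min_{x\in\mathbb{R}^N}F(x)$. Norms: for each $i$ a positive definite $B_i\in\mathbb{R}^{N_i\times N_i}$ is fixed, $\|t\|_{(i)}=\langle B_it,t\rangle^{1/2}$, $\|s\|_{(i)}^*=\langle B_i^{-1}s,s\rangle^{1/2}$, and for positive weights $w=(w_1,\dots,w_n)$, $\|x\|_w=\left(\sum_{i=1}^nw_i\|x^{(i)}\|_{(i)}^2\right)^{1/2}$. Partial separability: a smooth convex $f$ is partially separable of degree $\omega$ if there is a collection $\mathcal{J}$ of subsets of $\{1,\dots,n\}$ with $f=\sum_{J\in\mathcal{J}}f_J$ and $\max_{J\in\mathcal{J}}|J|\le\omega$, where each $f_J$ is a smooth convex function depending only on $x^{(i)}$, $i\in J$. Block Lipschitz gradient: for all $x\in\mathbb{R}^N$, all $i$ and all $t\in\mathbb{R}^{N_i}$, $\|(f'(x+U_it))^{(i)}-(f'(x))^{(i)}\|_{(i)}^*\le L_i\|t\|_{(i)}$. Strong convexity: $\phi:\mathbb{R}^N\to\mathbb{R}\cup\{+\infty\}$ is strongly convex with respect to $\|\cdot\|_w$ with convexity parameter $\mu_\phi(w)\ge0$ if for all $x,y\in\operatorname{dom}\phi$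 and any subgradient $\phi'(x)$ of $\phi$ at $x$, $\phi(y)\ge\phi(x)+\langle\phi'(x),y-x\rangle+\frac{\mu_\phi(w)}2\|y-x\|_w^2$. The value $\mu_\phi(w)=0$ corresponds to plain convexity. $\mu_F(L)$ and $\mu_f(L)$ are such parameters for $F$ and $f$ with weights $w=L$. Fully parallel coordinate descent method: for $k=0,1,2,\dots$, $$h_k=\arg\min_{h\in\mathbb{R}^N}\Big\{f(x_k)+\langle f'(x_k),h\rangle+\tfrac\omega2\sum_{i=1}^n\langle L_iB_ih^{(i)},h^{(i)}\rangle+\Psi(x_k+h)\Big\},\qquad x_{k+1}=x_k+h_k.$$ *)

theory Defs
  imports "HOL-Analysis.Analysis"
begin

text \<open>
  Coordinates of the space of dimension \<open>N\<close> are indexed by the finite type \<open>'m\<close>, blocks by the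
  finite type \<open>'n\<close>, and \<open>blk j\<close> is the block containing coordinate \<open>j\<close>.  Thus \<open>U\<^sub>i\<close>
  consists of the columns \<open>j\<close> of the identity with \<open>blk j = i\<close>, and \<open>N\<^sub>i\<close> is their number.
  As the block dimensions differ, the space of dimension \<open>N\<^sub>i\<close> is represented by its isometric
  image under \<open>U\<^sub>i\<close>, namely the vectors vanishing outside block \<open>i\<close>.  An \<open>N\<^sub>i \<times> N\<^sub>i\<close> matrix
  is accordingly an \<open>N \<times> N\<close> matrix whose entries vanish outside block \<open>(i,i)\<close>.
\<close>

definition block_space :: "('m \<Rightarrow> 'n) \<Rightarrow> 'n \<Rightarrow> (real ^ 'm::finite) set" where
  "block_space blk i = {t. \<forall>j. blk j \<noteq> i \<longrightarrow> t $ j = 0}"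

text \<open>The block \<open>x\<^sup>(\<^sup>i\<^sup>) = U\<^sub>i\<^sup>T x\<close>, as an element of \<open>block_space blk i\<close>.\<close>

definition block :: "('m \<Rightarrow> 'n) \<Rightarrow> 'n \<Rightarrow> real ^ 'm::finite \<Rightarrow> real ^ 'm" where
  "block blk i x = (\<chi> j. if blk j = i then x $ j else 0)"

definition block_matrix :: "('m \<Rightarrow> 'n) \<Rightarrow> 'n \<Rightarrow> real ^ 'm ^ 'm::finite \<Rightarrow> bool" where
  "block_matrix blk i M \<longleftrightarrow> (\<forall>j k. \<not> (blk j = i \<and> blk k = i) \<longrightarrow> M $ j $ k = 0)"

text \<open>The \<open>N\<^sub>i \<times> N\<^sub>i\<close> identity.\<close>

definition block_id :: "('m \<Rightarrow> 'n) \<Rightarrow> 'n \<Rightarrow> real ^ 'm ^ 'm::finite" where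
  "block_id blk i = (\<chi> j k. if j = k \<and> blk j = i then 1 else 0)"

text \<open>The inverse as an \<open>N\<^sub>i \<times> N\<^sub>i\<close> matrix; the padded \<open>N \<times> N\<close> matrix is singular in general,
  so \<open>matrix_inv\<close> does not apply.\<close>

definition block_inv :: "('m \<Rightarrow> 'n) \<Rightarrow> 'n \<Rightarrow> real ^ 'm ^ 'm::finite \<Rightarrow> real ^ 'm ^ 'm" where
  "block_inv blk i M =
     (THE C. block_matrix blk i C \<and> M ** C = block_id blk i \<and> C ** M = block_id blk i)"

definition block_posdef :: "('m \<Rightarrow> 'n) \<Rightarrow> 'n \<Rightarrow> real ^ 'm ^ 'm::finite \<Rightarrow> bool" where
  "block_posdef blk i M \<longleftrightarrow> block_matrix blk i M \<and> transpose M = M \<and>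
     (\<forall>t \<in> block_space blk i. t \<noteq> 0 \<longrightarrow> 0 < (M *v t) \<bullet> t)"

definition block_norm :: "('n \<Rightarrow> real ^ 'm ^ 'm) \<Rightarrow> 'n \<Rightarrow> real ^ 'm::finite \<Rightarrow> real" where
  "block_norm B i t = sqrt ((B i *v t) \<bullet> t)"

definition block_dual_norm ::
    "('m \<Rightarrow> 'n) \<Rightarrow> ('n \<Rightarrow> real ^ 'm ^ 'm) \<Rightarrow> 'n \<Rightarrow> real ^ 'm::finite \<Rightarrow> real" where
  "block_dual_norm blk B i s = sqrt ((block_inv blk i (B i) *v s) \<bullet> s)"

definition weighted_norm ::
    "('m \<Rightarrow> 'n) \<Rightarrow> ('n \<Rightarrow> real ^ 'm ^ 'm) \<Rightarrow> ('n::finite \<Rightarrow> real) \<Rightarrow> real ^ 'm::finite \<Rightarrow> real" where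
  "weighted_norm blk B w x = sqrt (\<Sum>i\<in>UNIV. w i * (block_norm B i (block blk i x))\<^sup>2)"

text \<open>Convexity and closedness of an extended-valued function on \<open>V\<close> are those of its epigraph;
  only the values of the function on \<open>V\<close> matter.\<close>

definition closed_convex_fun :: "'a::real_normed_vector set \<Rightarrow> ('a \<Rightarrow> ereal) \<Rightarrow> bool" where
  "closed_convex_fun V \<phi> \<longleftrightarrow> (\<forall>t\<in>V. \<phi> t \<noteq> -\<infinity>) \<and>
     convex {(t, r). t \<in> V \<and> \<phi> t \<le> ereal r} \<and> closed {(t, r). t \<in> V \<and> \<phi> t \<le> ereal r}"

definition block_separable_closed_convex ::
    "('m \<Rightarrow> 'n::finite) \<Rightarrow> (real ^ 'm::finite \<Rightarrow> ereal) \<Rightarrow> bool" where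
  "block_separable_closed_convex blk \<Psi> \<longleftrightarrow>
     (\<exists>\<psi>. (\<forall>i. closed_convex_fun (block_space blk i) (\<psi> i)) \<and>
          (\<forall>x. \<Psi> x = (\<Sum>i\<in>UNIV. \<psi> i (block blk i x))))"

text \<open>For a finite convex function on the whole space, differentiability everywhere already implies
  continuity of the gradient, so differentiability is what smoothness amounts to here.\<close>

definition smooth_convex :: "(real ^ 'm::finite \<Rightarrow> real) \<Rightarrow> bool" where
  "smooth_convex f \<longleftrightarrow> convex_on UNIV f \<and> f differentiable_on UNIV"

definition partially_separable ::
    "('m \<Rightarrow> 'n::finite) \<Rightarrow> nat \<Rightarrow> (real ^ 'm::finite \<Rightarrow> real) \<Rightarrow> bool" where
  "partially_separable blk \<omega> f \<longleftrightarrow>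
     (\<exists>(\<J> :: 'n set set) fJ.
        (\<forall>x. f x = (\<Sum>J\<in>\<J>. fJ J x)) \<and>
        (\<forall>J\<in>\<J>. card J \<le> \<omega> \<and> smooth_convex (fJ J) \<and>
           (\<forall>x y. (\<forall>i\<in>J. block blk i x = block blk i y) \<longrightarrow> fJ J x = fJ J y)))"

definition block_lipschitz_gradient ::
    "('m \<Rightarrow> 'n) \<Rightarrow> ('n \<Rightarrow> real ^ 'm ^ 'm) \<Rightarrow> ('n \<Rightarrow> real) \<Rightarrow>
     (real ^ 'm::finite \<Rightarrow> real ^ 'm) \<Rightarrow> bool" where
  "block_lipschitz_gradient blk B L f' \<longleftrightarrow>
     (\<forall>x i. \<forall>t \<in> block_space blk i.
        block_dual_norm blk B i (block blk i (f' (x + t)) - block blk i (f' x))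
          \<le> L i * block_norm B i t)"

definition effective_dom :: "('a \<Rightarrow> ereal) \<Rightarrow> 'a set" where
  "effective_dom \<phi> = {x. \<phi> x < \<infinity>}"

definition subgradient :: "('a::real_inner \<Rightarrow> ereal) \<Rightarrow> 'a \<Rightarrow> 'a \<Rightarrow> bool" where
  "subgradient \<phi> x s \<longleftrightarrow>
     x \<in> effective_dom \<phi> \<and> (\<forall>y. \<phi> y \<ge> \<phi> x + ereal (s \<bullet> (y - x)))"

definition strong_convexity_parameter ::
    "('m \<Rightarrow> 'n) \<Rightarrow> ('n \<Rightarrow> real ^ 'm ^ 'm) \<Rightarrow> ('n::finite \<Rightarrow> real) \<Rightarrow>
     (real ^ 'm::finite \<Rightarrow> ereal) \<Rightarrow> real \<Rightarrow> bool" where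
  "strong_convexity_parameter blk B w \<phi> \<mu> \<longleftrightarrow> 0 \<le> \<mu> \<and>
     (\<forall>x \<in> effective_dom \<phi>. \<forall>y \<in> effective_dom \<phi>. \<forall>s. subgradient \<phi> x s \<longrightarrow>
        \<phi> y \<ge> \<phi> x + ereal (s \<bullet> (y - x)) + ereal (\<mu> / 2 * (weighted_norm blk B w (y - x))\<^sup>2))"

text \<open>The objective minimised over \<open>h\<close> at the iterate \<open>x\<close>.\<close>

definition pcdm_model ::
    "('m \<Rightarrow> 'n) \<Rightarrow> ('n \<Rightarrow> real ^ 'm ^ 'm) \<Rightarrow> ('n::finite \<Rightarrow> real) \<Rightarrow> nat \<Rightarrow>
     (real ^ 'm::finite \<Rightarrow> real) \<Rightarrow> (real ^ 'm \<Rightarrow> real ^ 'm) \<Rightarrow> (real ^ 'm \<Rightarrow> ereal) \<Rightarrow>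
     real ^ 'm \<Rightarrow> real ^ 'm \<Rightarrow> ereal" where
  "pcdm_model blk B L \<omega> f f' \<Psi> x h =
     ereal (f x + f' x \<bullet> h
       + real \<omega> / 2 * (\<Sum>i\<in>UNIV. (L i *\<^sub>R (B i *v block blk i h)) \<bullet> block blk i h))
     + \<Psi> (x + h)"

definition pcdm_iterates ::
    "('m \<Rightarrow> 'n) \<Rightarrow> ('n \<Rightarrow> real ^ 'm ^ 'm) \<Rightarrow> ('n::finite \<Rightarrow> real) \<Rightarrow> nat \<Rightarrow>
     (real ^ 'm::finite \<Rightarrow> real) \<Rightarrow> (real ^ 'm \<Rightarrow> real ^ 'm) \<Rightarrow> (real ^ 'm \<Rightarrow> ereal) \<Rightarrow>
     (nat \<Rightarrow> real ^ 'm) \<Rightarrow> bool" where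
  "pcdm_iterates blk B L \<omega> f f' \<Psi> x \<longleftrightarrow>
     (\<exists>h. \<forall>k. is_arg_min (pcdm_model blk B L \<omega> f f' \<Psi> (x k)) (\<lambda>_. True) (h k) \<and>
              x (Suc k) = x k + h k)"

end

theory Submission
  imports Defs
begin

text \<open>
  On the blocks of a summand \<open>f\<^sub>J\<close>, the vector \<open>x + h\<close> is a convex combination of \<open>x\<close> and of
  the points \<open>x + \<omega> h\<^sup>(\<^sup>i\<^sup>)\<close>.  Convexity of the \<open>f\<^sub>J\<close> and the block Lipschitz condition therefore
  give \<open>f (x + h) \<le> f x + \<langle>f' x, h\<rangle> + \<omega> / 2 * \<parallel>h\<parallel>\<^sub>L\<^sup>2\<close>, so the model majorizes \<open>F\<close>.
  Strong convexity of \<open>f\<close> bounds the model from above and yields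
  \<open>F x\<^sub>k\<^sub>+\<^sub>1 \<le> F y + (\<omega> - \<mu>f) / 2 * \<parallel>y - x\<^sub>k\<parallel>\<^sub>L\<^sup>2\<close> for every \<open>y\<close>.  For
  \<open>y = \<lambda> z + (1 - \<lambda>) x\<^sub>k\<close> with \<open>\<lambda> = \<mu>F / (\<omega> + \<mu>F - \<mu>f)\<close>, the quadratic terms cancel by
  strong convexity of \<open>F\<close>, and \<open>F x\<^sub>k\<^sub>+\<^sub>1 \<le> \<lambda> F z + (1 - \<lambda>) F x\<^sub>k\<close> for every \<open>z\<close>.  This also shows
  that \<open>F\<close> is bounded below, and the infimum over \<open>z\<close> gives the contraction; the infimum need not
  be known to be attained.
\<close>

section \<open>Blocks and their norms\<close>

lemma linear_block: "linear (block blk i)"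
  by (rule linearI) (auto simp: block_def vec_eq_iff)

lemma block_in_block_space: "block blk i x \<in> block_space blk i"
  by (simp add: block_def block_space_def)

lemma block_of_block_space: "t \<in> block_space blk i \<Longrightarrow> block blk i t = t"
  by (auto simp: block_def block_space_def vec_eq_iff)

lemma block_block: "block blk i (block blk k x) = (if i = k then block blk i x else 0)"
  by (auto simp: block_def vec_eq_iff)

lemma sum_block:
  fixes blk :: "'m::finite \<Rightarrow> 'n::finite"
  shows "(\<Sum>i\<in>UNIV. block blk i x) = x"
  by (simp add: vec_eq_iff block_def)

lemma block_id_mult: "block_id blk i *v x = block blk i x"
  by (auto simp: vec_eq_iff block_id_def block_def matrix_vector_mult_def mult_delta_left)

lemma block_inner: "block blk i x \<bullet> y = x \<bullet> block blk i y"
  by (auto simp: inner_vec_def block_def intro!: sum.cong)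

text \<open>\<open>block_id blk i\<close> acts as the orthogonal projector P onto block
  \<open>i\<close>, so being supported on the block means being absorbed by P on both sides. In this
  form the inverse can be treated by matrix products alone.\<close>

lemma block_matrix_iff:
  "block_matrix blk i M \<longleftrightarrow> block_id blk i ** M = M \<and> M ** block_id blk i = M"
proof -
  have "(block_id blk i ** M) $ j $ k = (block_id blk i *v column k M) $ j"
    "(M ** block_id blk i) $ j $ k = (block_id blk i *v row j M) $ k" for j k
    by (auto simp: block_id_def matrix_matrix_mult_def matrix_vector_mult_def column_def row_def
        intro!: sum.cong)
  then have *: "(block_id blk i ** M) $ j $ k = (if blk j = i then M $ j $ k else 0)"
    "(M ** block_id blk i) $ j $ k = (if blk k = i then M $ j $ k else 0)" for j k
    by (simp_all add: block_id_mult block_def column_def row_def)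
  show ?thesis
    unfolding block_matrix_def vec_eq_iff * by auto
qed

lemma block_matrix_mult_in:
  assumes "block_matrix blk i M"
  shows "M *v x \<in> block_space blk i"
proof -
  have "M *v x = block blk i (M *v x)"
    using assms by (simp add: block_matrix_iff matrix_vector_mul_assoc flip: block_id_mult)
  then show ?thesis
    using block_in_block_space by metis
qed

text \<open>Justifies the definite description behind \<open>block_inv\<close>. Completing M by the
  identity outside the block gives an invertible matrix A = M + (1 - P); its inverse D commutes with
  P, and P D is the inverse inside the block.\<close>

lemma block_inv:
  fixes M :: "real ^ 'm ^ 'm::finite"
  assumes "block_posdef blk i M"
  shows "block_matrix blk i (block_inv blk i M)"
    and "M ** block_inv blk i M = block_id blk i"
    and "block_inv blk i M ** M = block_id blk i"
proof -
  let ?P = "block_id blk i" and ?A = "M + (mat 1 - block_id blk i)"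
  have M: "?P ** M = M" "M ** ?P = M"
    and pos: "\<And>t. t \<in> block_space blk i \<Longrightarrow> t \<noteq> 0 \<Longrightarrow> 0 < (M *v t) \<bullet> t"
    using assms by (auto simp: block_posdef_def block_matrix_iff)
  have PP: "?P ** ?P = ?P"
    by (rule conjunct1[OF iffD1[OF block_matrix_iff]]) (simp add: block_matrix_def block_id_def)
  have AP: "?A ** ?P = M" and PA: "?P ** ?A = M"
  proof -
    have "M *v block blk i x = M *v x" "block blk i (M *v x) = M *v x" for x
      by (simp_all add: matrix_vector_mul_assoc M flip: block_id_mult)
    then show "?A ** ?P = M" "?P ** ?A = M"
      by (simp_all only: matrix_eq matrix_vector_mul_assoc[symmetric] matrix_vector_mult_add_rdistrib
          matrix_vector_mult_diff_rdistrib block_id_mult block_block matrix_vector_mul_lid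
          linear_add[OF linear_block] linear_diff[OF linear_block] if_True diff_self add_0_right simp_thms)
  qed
  \<comment> \<open>Applying P to A x = 0 gives M x = 0; then A x = 0 leaves x = P x, so x lies in
    the block and positive definiteness forces x = 0.\<close>
  have inj: "x = 0" if "?A *v x = 0" for x
  proof -
    have "M *v x = ?P *v (?A *v x)"
      by (simp add: matrix_vector_mul_assoc PA)
    then have Mx: "M *v x = 0"
      using that by simp
    then have "x = block blk i x"
      using that by (simp add: matrix_vector_mult_add_rdistrib matrix_vector_mult_diff_rdistrib
          block_id_mult)
    then have "x \<in> block_space blk i"
      by (metis block_in_block_space)
    with pos Mx show "x = 0"
      by force
  qed
  then obtain D where DA: "D ** ?A = mat 1"
    using matrix_left_invertible_ker by blast
  then have AD: "?A ** D = mat 1"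
    by (simp add: matrix_left_right_inverse)
  \<comment> \<open>Since A P and P A both equal M, sandwiching this product between two copies of D
    moves P from one side of D to the other.\<close>
  have DP: "D ** ?P = ?P ** D"
  proof -
    have "D ** ?P = D ** (?P ** ?A) ** D"
      by (simp add: AD flip: matrix_mul_assoc)
    also have "\<dots> = (D ** ?A) ** ?P ** D"
      by (simp only: AP PA matrix_mul_assoc[symmetric])
    finally show ?thesis
      by (simp add: DA)
  qed
  define C where "C = ?P ** D"
  have C: "block_matrix blk i C \<and> M ** C = ?P \<and> C ** M = ?P"
  proof (intro conjI)
    show "block_matrix blk i C"
      unfolding block_matrix_iff C_def
      by (metis DP PP matrix_mul_assoc)
    have "M ** C = M ** D"
      by (simp add: C_def matrix_mul_assoc M)
    also have "\<dots> = ?P ** (?A ** D)"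
      by (simp only: matrix_mul_assoc PA)
    finally show "M ** C = ?P"
      by (simp add: AD)
    have "C ** M = D ** M"
      by (simp add: C_def M flip: matrix_mul_assoc DP)
    also have "\<dots> = (D ** ?A) ** ?P"
      by (simp only: matrix_mul_assoc[symmetric] AP)
    finally show "C ** M = ?P"
      by (simp add: DA)
  qed
  have "\<exists>!C. block_matrix blk i C \<and> M ** C = ?P \<and> C ** M = ?P"
  proof (rule ex1I, rule C)
    fix C' assume C': "block_matrix blk i C' \<and> M ** C' = ?P \<and> C' ** M = ?P"
    then have "C' = (C ** M) ** C'"
      using C by (simp add: block_matrix_iff)
    also have "\<dots> = C ** (M ** C')"
      by (simp only: matrix_mul_assoc)
    also have "\<dots> = C"
      using C C' by (simp add: block_matrix_iff)
    finally show "C' = C" .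
  qed
  from theI'[OF this] show "block_matrix blk i (block_inv blk i M)"
    "M ** block_inv blk i M = block_id blk i" "block_inv blk i M ** M = block_id blk i"
    by (simp_all add: block_inv_def)
qed

lemma block_posdef_nonneg:
  "block_posdef blk i M \<Longrightarrow> t \<in> block_space blk i \<Longrightarrow> 0 \<le> (M *v t) \<bullet> t"
  by (cases "t = 0") (auto simp: block_posdef_def less_imp_le)

lemma block_posdef_inner_commute:
  fixes M :: "real ^ 'm ^ 'm::finite"
  assumes "block_posdef blk i M"
  shows "(M *v x) \<bullet> y = (M *v y) \<bullet> x"
  using assms by (metis block_posdef_def dot_lmul_matrix inner_commute transpose_matrix_vector)

lemma block_posdef_Cauchy_Schwarz:
  assumes M: "block_posdef blk i M" and u: "u \<in> block_space blk i" and t: "t \<in> block_space blk i"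
  shows "(M *v u) \<bullet> t \<le> sqrt ((M *v u) \<bullet> u) * sqrt ((M *v t) \<bullet> t)"
proof (cases "t = 0")
  case False
  let ?uu = "(M *v u) \<bullet> u" and ?ut = "(M *v u) \<bullet> t" and ?tt = "(M *v t) \<bullet> t"
  \<comment> \<open>This \<open>a\<close> minimizes the quadratic form of M at
    \<open>u - a *\<^sub>R t\<close>; its nonnegativity there is the squared inequality.\<close>
  define a where "a = ?ut / ?tt"
  have tt: "0 < ?tt"
    using M t False by (auto simp: block_posdef_def)
  have "u - a *\<^sub>R t \<in> block_space blk i"
    using u t by (simp add: block_space_def)
  then have "0 \<le> (M *v (u - a *\<^sub>R t)) \<bullet> (u - a *\<^sub>R t)"
    by (rule block_posdef_nonneg[OF M])
  also have "\<dots> = ?uu - 2 * a * ?ut + a\<^sup>2 * ?tt"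
    using block_posdef_inner_commute[OF M, of t u]
    by (simp add: matrix_vector_mult_diff_distrib matrix_vector_mult_scaleR inner_diff_left
        inner_diff_right power2_eq_square algebra_simps)
  also have "\<dots> = ?uu - ?ut\<^sup>2 / ?tt"
    using tt by (simp add: a_def power2_eq_square field_simps)
  finally have "?ut\<^sup>2 \<le> ?uu * ?tt"
    using tt by (simp add: field_simps)
  then show ?thesis
    by (metis real_le_rsqrt real_sqrt_mult)
qed simp

text \<open>Writing s = B u with u in the block turns the dual norm of s into the norm of u, and the
  claim into Cauchy-Schwarz for the form of \<open>B i\<close>.\<close>

lemma inner_le_block_dual_norm:
  assumes M: "block_posdef blk i (B i)" and s: "s \<in> block_space blk i" and t: "t \<in> block_space blk i"
  shows "s \<bullet> t \<le> block_dual_norm blk B i s * block_norm B i t"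
proof -
  note inv = block_inv[OF M]
  define u where "u = block_inv blk i (B i) *v s"
  have "B i *v u = s"
    by (simp add: u_def matrix_vector_mul_assoc inv block_id_mult block_of_block_space s)
  moreover have "u \<in> block_space blk i"
    unfolding u_def by (rule block_matrix_mult_in[OF inv(1)])
  ultimately show ?thesis
    using block_posdef_Cauchy_Schwarz[OF M _ t, of u]
    by (simp add: block_dual_norm_def block_norm_def u_def inner_commute)
qed

section \<open>The weighted norm: its square, scaling and continuity\<close>

lemma weighted_norm_power2:
  fixes blk :: "'m::finite \<Rightarrow> 'n::finite"
  assumes "\<And>i. block_posdef blk i (B i)" "\<And>i. 0 \<le> w i"
  shows "(weighted_norm blk B w x)\<^sup>2
    = (\<Sum>i\<in>UNIV. w i * ((B i *v block blk i x) \<bullet> block blk i x))"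
proof -
  have "0 \<le> (B i *v block blk i x) \<bullet> block blk i x" for i
    by (rule block_posdef_nonneg[OF assms(1) block_in_block_space])
  then show ?thesis
    using assms(2) by (simp add: weighted_norm_def block_norm_def sum_nonneg)
qed

lemma weighted_norm_power2_scaleR:
  fixes blk :: "'m::finite \<Rightarrow> 'n::finite"
  assumes "\<And>i. block_posdef blk i (B i)" "\<And>i. 0 \<le> w i"
  shows "(weighted_norm blk B w (a *\<^sub>R x))\<^sup>2 = a\<^sup>2 * (weighted_norm blk B w x)\<^sup>2"
  unfolding weighted_norm_power2[OF assms] sum_distrib_left
  by (simp add: linear_cmul[OF linear_block] matrix_vector_mult_scaleR power2_eq_square algebra_simps)

lemma continuous_on_block [continuous_intros]:
  "continuous_on S g \<Longrightarrow> continuous_on S (\<lambda>y. block blk i (g y))"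
  by (rule bounded_linear.continuous_on[OF linear_block[unfolded linear_conv_bounded_linear]])

lemma continuous_on_weighted_norm [continuous_intros]:
  fixes blk :: "'m::finite \<Rightarrow> 'n::finite"
  assumes "continuous_on S g"
  shows "continuous_on S (\<lambda>y. weighted_norm blk B w (g y))"
  unfolding weighted_norm_def block_norm_def
  by (intro continuous_intros assms bounded_linear.continuous_on[OF matrix_vector_mul_bounded_linear])

section \<open>Separable overapproximation of the smooth part\<close>

lemma GDERIV_along_line:
  assumes "GDERIV f (x + s *\<^sub>R t) :> d"
  shows "((\<lambda>s. f (x + s *\<^sub>R t)) has_real_derivative d \<bullet> t) (at s)"
proof -
  have "((\<lambda>s. x + s *\<^sub>R t) has_derivative (\<lambda>s. s *\<^sub>R t)) (at s)"
    by (auto intro!: derivative_eq_intros)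
  moreover have "(f has_derivative (\<lambda>h. h \<bullet> d)) (at (x + s *\<^sub>R t))"
    using assms by (simp add: gderiv_def)
  ultimately have "(f \<circ> (\<lambda>s. x + s *\<^sub>R t) has_derivative (\<lambda>h. h \<bullet> d) \<circ> (\<lambda>s. s *\<^sub>R t)) (at s)"
    by (rule diff_chain_at)
  then show ?thesis
    by (simp add: has_field_derivative_def o_def inner_commute mult_commute_abs)
qed

text \<open>The descent lemma restricted to one block: the Lipschitz condition bounds the growth of
  the directional derivative along t linearly, which integrates to the quadratic term.\<close>

lemma block_descent:
  assumes B: "block_posdef blk i (B i)"
    and f': "\<And>y. GDERIV f y :> f' y"
    and lip: "block_lipschitz_gradient blk B L f'"
    and t: "t \<in> block_space blk i"
  shows "f (x + t) \<le> f x + f' x \<bullet> t + L i / 2 * ((B i *v t) \<bullet> t)"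
proof -
  let ?b = "(B i *v t) \<bullet> t"
  have norm_t: "block_norm B i t * block_norm B i t = ?b"
    using block_posdef_nonneg[OF B t] by (simp add: block_norm_def)
  \<comment> \<open>The gap between f on the segment and its quadratic bound, up to the constant
    \<open>f x\<close>; it suffices that \<open>g\<close> does not increase on [0, 1].\<close>
  define g where "g s = f (x + s *\<^sub>R t) - s * (f' x \<bullet> t) - L i / 2 * s\<^sup>2 * ?b" for s
  have "g 1 \<le> g 0"
  proof (rule DERIV_nonpos_imp_nonincreasing[of 0 1])
    fix s :: real assume s: "0 \<le> s" "s \<le> 1"
    have d: "(g has_real_derivative (f' (x + s *\<^sub>R t) \<bullet> t - f' x \<bullet> t - L i * s * ?b)) (at s)"
      unfolding g_def by (auto intro!: derivative_eq_intros GDERIV_along_line f')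
    have st: "s *\<^sub>R t \<in> block_space blk i"
      using t by (simp add: block_space_def)
    have "f' (x + s *\<^sub>R t) \<bullet> t - f' x \<bullet> t
        = (block blk i (f' (x + s *\<^sub>R t)) - block blk i (f' x)) \<bullet> t"
      by (simp add: inner_diff_left block_inner block_of_block_space t)
    also have "\<dots> \<le> block_dual_norm blk B i (block blk i (f' (x + s *\<^sub>R t)) - block blk i (f' x))
        * block_norm B i t"
      using block_in_block_space[of blk i]
      by (intro inner_le_block_dual_norm B t) (simp add: block_space_def)
    also have "\<dots> \<le> (L i * block_norm B i (s *\<^sub>R t)) * block_norm B i t"
    proof (rule mult_right_mono)
      show "block_dual_norm blk B i (block blk i (f' (x + s *\<^sub>R t)) - block blk i (f' x))
          \<le> L i * block_norm B i (s *\<^sub>R t)"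
        using lip st by (simp add: block_lipschitz_gradient_def)
    qed (simp add: block_norm_def block_posdef_nonneg[OF B t])
    also have "block_norm B i (s *\<^sub>R t) = s * block_norm B i t"
      using s by (simp add: block_norm_def matrix_vector_mult_scaleR real_sqrt_mult)
    also have "L i * (s * block_norm B i t) * block_norm B i t = L i * s * ?b"
      by (simp add: norm_t[symmetric])
    finally show "\<exists>y. (g has_real_derivative y) (at s) \<and> y \<le> 0"
      using d by (intro exI[of _ "f' (x + s *\<^sub>R t) \<bullet> t - f' x \<bullet> t - L i * s * ?b"]) simp
  qed simp
  then show ?thesis
    by (simp add: g_def)
qed

text \<open>On the blocks in \<open>J\<close>, the increment \<open>h\<close> is the convex combination of the
  single-block increments \<open>\<omega> h\<^sup>(\<^sup>i\<^sup>)\<close>, \<open>i \<in> J\<close>, each with weight \<open>1 / \<omega>\<close>, and of \<open>0\<close>.\<close>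

lemma partially_separable_increment:
  fixes blk :: "'m::finite \<Rightarrow> 'n::finite"
  assumes sep: "partially_separable blk \<omega> f" and \<omega>: "1 \<le> \<omega>"
  shows "f (x + h) - f x
    \<le> (1 / real \<omega>) * (\<Sum>i\<in>UNIV. f (x + real \<omega> *\<^sub>R block blk i h) - f x)"
proof -
  obtain \<J> :: "'n set set" and fJ where f: "\<And>x. f x = (\<Sum>J\<in>\<J>. fJ J x)"
    and J: "\<And>J. J \<in> \<J> \<Longrightarrow> card J \<le> \<omega>" "\<And>J. J \<in> \<J> \<Longrightarrow> smooth_convex (fJ J)"
    and dep: "\<And>J x y. J \<in> \<J> \<Longrightarrow> \<forall>i\<in>J. block blk i x = block blk i y \<Longrightarrow> fJ J x = fJ J y"
    using sep unfolding partially_separable_def by blast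
  have inc: "fJ J (x + h) - fJ J x
      \<le> (1 / real \<omega>) * (\<Sum>i\<in>UNIV. fJ J (x + real \<omega> *\<^sub>R block blk i h) - fJ J x)"
    if JJ: "J \<in> \<J>" for J
  proof -
    \<comment> \<open>\<open>?c\<close> is the weight left for \<open>x\<close> itself; it is
      nonnegative because J has at most \<omega> elements.\<close>
    let ?z = "\<lambda>i. x + real \<omega> *\<^sub>R block blk i h" and ?c = "1 - real (card J) / real \<omega>"
    define y where "y = ?c *\<^sub>R x + (\<Sum>i\<in>J. (1 / real \<omega>) *\<^sub>R ?z i)"
    have conv: "convex_on UNIV (fJ J)"
      using J(2)[OF JJ] by (simp add: smooth_convex_def)
    have y: "y = x + (\<Sum>i\<in>J. block blk i h)"
      using \<omega> by (simp add: y_def scaleR_add_right sum.distrib scaleR_left_diff_distrib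
          sum_constant_scaleR del: sum_constant)
    have "block blk k (x + h) = block blk k y" if "k \<in> J" for k
    proof -
      have "block blk k (\<Sum>i\<in>J. block blk i h) = (\<Sum>i\<in>J. if k = i then block blk k h else 0)"
        by (simp add: linear_sum[OF linear_block] block_block)
      also have "\<dots> = block blk k h"
        using that by simp
      finally show ?thesis
        by (simp add: y linear_add[OF linear_block])
    qed
    then have "fJ J (x + h) = fJ J y"
      by (intro dep JJ) simp
    also have "\<dots> \<le> ?c * fJ J x + (\<Sum>i\<in>J. (1 / real \<omega>) * fJ J (?z i))"
    proof -
      \<comment> \<open>Jensen's inequality over one index set: \<open>None\<close> carries the
        point \<open>x\<close>, \<open>Some i\<close> the point \<open>?z i\<close>.\<close>
      define z where "z k = (case k of None \<Rightarrow> x | Some i \<Rightarrow> ?z i)" for k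
      define a where "a k = (case k of None \<Rightarrow> ?c | Some i \<Rightarrow> 1 / real \<omega>)" for k :: "'n option"
      let ?K = "insert None (Some ` J)"
      have K: "sum g ?K = g None + (\<Sum>i\<in>J. g (Some i))" for g :: "'n option \<Rightarrow> 'c::comm_monoid_add"
        by (simp add: sum.reindex)
      have "sum a ?K = 1"
        unfolding K by (simp add: a_def)
      then have "fJ J (\<Sum>k\<in>?K. a k *\<^sub>R z k) \<le> (\<Sum>k\<in>?K. a k * fJ J (z k))"
        using J(1)[OF JJ] \<omega>
        by (intro convex_on_sum[OF _ _ conv]) (auto simp: a_def)
      then show ?thesis
        unfolding K y_def by (simp add: a_def z_def)
    qed
    also have "\<dots> = fJ J x + (1 / real \<omega>) * (\<Sum>i\<in>J. fJ J (?z i) - fJ J x)"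
      by (simp only: sum_subtractf sum_constant sum_distrib_left[symmetric]) (simp add: algebra_simps)
    \<comment> \<open>A move in a block outside J does not change \<open>fJ J\<close>, so the added
      terms vanish. With a range independent of J, the two sums can later be exchanged.\<close>
    also have "(\<Sum>i\<in>J. fJ J (?z i) - fJ J x) = (\<Sum>i\<in>UNIV. fJ J (?z i) - fJ J x)"
    proof (rule sum.mono_neutral_left)
      have "block blk k (?z i) = block blk k x" if "i \<notin> J" "k \<in> J" for i k
        using that by (auto simp: linear_add[OF linear_block] linear_cmul[OF linear_block] block_block)
      then show "\<forall>i\<in>UNIV - J. fJ J (?z i) - fJ J x = 0"
        using dep[OF JJ] by (metis DiffD2 diff_self)
    qed auto
    finally show ?thesis
      by simp
  qed
  have "f (x + h) - f x = (\<Sum>J\<in>\<J>. fJ J (x + h) - fJ J x)"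
    by (simp add: f sum_subtractf)
  also have "\<dots> \<le> (\<Sum>J\<in>\<J>. (1 / real \<omega>) * (\<Sum>i\<in>UNIV. fJ J (x + real \<omega> *\<^sub>R block blk i h) - fJ J x))"
    by (intro sum_mono inc)
  also have "\<dots> = (1 / real \<omega>) * (\<Sum>i\<in>UNIV. f (x + real \<omega> *\<^sub>R block blk i h) - f x)"
    unfolding sum_distrib_left[symmetric]
    by (subst sum.swap) (simp add: f sum_subtractf)
  finally show ?thesis .
qed

text \<open>Each single-block step is stretched by \<omega>, which multiplies its quadratic term by
  \<omega> squared; the factor 1 / \<omega> of the averaging brings this down to \<omega> and
  restores the linear term.\<close>

lemma separable_overapproximation:
  fixes blk :: "'m::finite \<Rightarrow> 'n::finite"
  assumes B: "\<And>i. block_posdef blk i (B i)" and L: "\<And>i. 0 \<le> L i" and \<omega>: "1 \<le> \<omega>"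
    and f': "\<And>y. GDERIV f y :> f' y"
    and sep: "partially_separable blk \<omega> f"
    and lip: "block_lipschitz_gradient blk B L f'"
  shows "f (x + h) \<le> f x + f' x \<bullet> h + real \<omega> / 2 * (weighted_norm blk B L h)\<^sup>2"
proof -
  let ?b = "\<lambda>i. (B i *v block blk i h) \<bullet> block blk i h"
  have "f (x + h) - f x
      \<le> (1 / real \<omega>) * (\<Sum>i\<in>UNIV. f (x + real \<omega> *\<^sub>R block blk i h) - f x)"
    by (rule partially_separable_increment[OF sep \<omega>])
  also have "\<dots> \<le> (1 / real \<omega>) * (\<Sum>i\<in>UNIV. real \<omega> * (f' x \<bullet> block blk i h)
      + L i / 2 * ((real \<omega>)\<^sup>2 * ?b i))"
  proof (intro mult_left_mono sum_mono)
    fix i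
    have "real \<omega> *\<^sub>R block blk i h \<in> block_space blk i"
      using block_in_block_space[of blk i h] by (simp add: block_space_def)
    from block_descent[where f = f and f' = f' and B = B and L = L, OF B f' lip this, of x]
    show "f (x + real \<omega> *\<^sub>R block blk i h) - f x
        \<le> real \<omega> * (f' x \<bullet> block blk i h) + L i / 2 * ((real \<omega>)\<^sup>2 * ?b i)"
      by (simp add: matrix_vector_mult_scaleR power2_eq_square algebra_simps)
  qed simp
  also have "\<dots> = (\<Sum>i\<in>UNIV. f' x \<bullet> block blk i h + real \<omega> / 2 * (L i * ?b i))"
    unfolding sum_distrib_left using \<omega>
    by (intro sum.cong) (simp_all add: power2_eq_square field_simps)
  also have "\<dots> = f' x \<bullet> (\<Sum>i\<in>UNIV. block blk i h) + real \<omega> / 2 * (\<Sum>i\<in>UNIV. L i * ?b i)"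
    by (simp add: sum.distrib inner_sum_right sum_distrib_left)
  finally show ?thesis
    by (simp add: sum_block weighted_norm_power2[OF B L] del: real_sqrt_pow2_iff)
qed

section \<open>Closed convex functions and their subgradients\<close>

text \<open>Fermat's rule with a smooth, not necessarily convex, perturbation: compare
  \<open>u\<close> with points on the segment towards y, bound \<phi> there by its chord, divide by
  the step length and let it tend to 0 from the right.\<close>

lemma subgradient_of_argmin_add_smooth:
  fixes u :: "'a::real_inner"
  assumes conv: "convex {(t, r). \<phi> t \<le> ereal r}"
    and fin: "\<bar>\<phi> u\<bar> \<noteq> \<infinity>"
    and g: "GDERIV g u :> g'"
    and argmin: "\<And>z. \<phi> u + ereal (g u) \<le> \<phi> z + ereal (g z)"
  shows "subgradient \<phi> u (- g')"
  unfolding subgradient_def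
proof (intro conjI allI)
  show "u \<in> effective_dom \<phi>"
    using fin by (auto simp: effective_dom_def)
  obtain a where a: "\<phi> u = ereal a"
    using fin by auto
  fix y
  \<comment> \<open>Stated for every real upper bound r, so that it also excludes the value minus
    infinity at \<open>y\<close>: some r would violate it.\<close>
  have key: "a - g' \<bullet> (y - u) \<le> r" if r: "\<phi> y \<le> ereal r" for r
  proof -
    define d where "d = y - u"
    have "((\<lambda>s. g (u + s *\<^sub>R d)) has_real_derivative g' \<bullet> d) (at 0)"
      using g by (intro GDERIV_along_line) simp
    then have "((\<lambda>s. (g (u + s *\<^sub>R d) - g u) / s) \<longlongrightarrow> g' \<bullet> d) (at 0)"
      by (simp add: DERIV_def)
    then have lim: "((\<lambda>s. (g (u + s *\<^sub>R d) - g u) / s) \<longlongrightarrow> g' \<bullet> d) (at_right 0)"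
      by (rule filterlim_mono) (simp_all add: at_within_le_at)
    have "a - r \<le> (g (u + s *\<^sub>R d) - g u) / s" if s: "0 < s" "s < 1" for s
    proof -
      have "(1 - s) *\<^sub>R (u, a) + s *\<^sub>R (y, r) \<in> {(t, r). \<phi> t \<le> ereal r}"
        using s a r by (intro convexD[OF conv]) auto
      then have le: "\<phi> (u + s *\<^sub>R d) \<le> ereal ((1 - s) * a + s * r)"
        by (simp add: d_def algebra_simps)
      have "ereal (a + g u) \<le> \<phi> (u + s *\<^sub>R d) + ereal (g (u + s *\<^sub>R d))"
        using argmin[of "u + s *\<^sub>R d"] by (simp add: a)
      also have "\<dots> \<le> ereal ((1 - s) * a + s * r) + ereal (g (u + s *\<^sub>R d))"
        by (rule add_right_mono[OF le])
      finally show ?thesis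
        using s by (simp add: field_simps)
    qed
    then have "\<forall>\<^sub>F s in at_right 0. a - r \<le> (g (u + s *\<^sub>R d) - g u) / s"
      using eventually_at_right_less[of "0::real"]
      by (auto simp: eventually_at_right_field intro!: exI[of _ 1])
    from tendsto_lowerbound[OF lim this] have "a - r \<le> g' \<bullet> d"
      by simp
    then show ?thesis
      by (simp add: d_def)
  qed
  show "\<phi> u + ereal (- g' \<bullet> (y - u)) \<le> \<phi> y"
  proof (cases "\<phi> y")
    case (real r)
    then show ?thesis using key[of r] by (simp add: a)
  next
    case MInf
    then show ?thesis using key[of "a - g' \<bullet> (y - u) - 1"] by simp
  qed simp
qed

text \<open>The epigraph of the composition is the preimage of the original epigraph under the
  continuous linear map (T, id).\<close>

lemma closed_convex_fun_comp_linear: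
  fixes T :: "'a::euclidean_space \<Rightarrow> 'b::euclidean_space"
  assumes \<phi>: "closed_convex_fun V \<phi>" and T: "linear T" "\<And>x. T x \<in> V"
  shows "closed_convex_fun UNIV (\<lambda>x. \<phi> (T x))"
proof -
  let ?T = "\<lambda>p :: 'a \<times> real. (T (fst p), snd p)"
  let ?E = "{(t, r). t \<in> V \<and> \<phi> t \<le> ereal r}"
  have epi: "{(t, r). t \<in> UNIV \<and> \<phi> (T t) \<le> ereal r} = ?T -` ?E"
    using T(2) by auto
  have "linear ?T"
    using T(1) by (auto intro!: linearI simp: linear_add linear_cmul)
  moreover from this have "continuous_on UNIV ?T"
    by (simp add: linear_continuous_on linear_conv_bounded_linear)
  ultimately have "convex (?T -` ?E)" "closed (?T -` ?E)"
    using \<phi> by (simp_all only: closed_convex_fun_def convex_linear_vimage closed_vimage)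
  then show ?thesis
    using \<phi> T(2) unfolding closed_convex_fun_def epi by blast
qed

text \<open>Closedness: \<open>\<phi> x + \<psi> x \<le> r\<close> holds iff no reals \<open>a < \<phi> x\<close> and \<open>b < \<psi> x\<close> satisfy
  \<open>r < a + b\<close>, which presents the epigraph as an intersection of closed sets.\<close>

lemma closed_convex_fun_add:
  fixes \<phi> \<psi> :: "'a::euclidean_space \<Rightarrow> ereal"
  assumes \<phi>: "closed_convex_fun UNIV \<phi>" and \<psi>: "closed_convex_fun UNIV \<psi>"
  shows "closed_convex_fun UNIV (\<lambda>x. \<phi> x + \<psi> x)"
proof -
  let ?E = "\<lambda>\<phi>. {(t, r). \<phi> t \<le> ereal r}"
  have c: "convex (?E \<phi>)" "convex (?E \<psi>)" "closed (?E \<phi>)" "closed (?E \<psi>)"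
    and ninf: "\<And>t. \<phi> t \<noteq> -\<infinity>" "\<And>t. \<psi> t \<noteq> -\<infinity>"
    using assms by (auto simp: closed_convex_fun_def)
  have split: "\<exists>a b. \<phi> t = ereal a \<and> \<psi> t = ereal b \<and> a + b \<le> r" if "\<phi> t + \<psi> t \<le> ereal r" for t r
    using that ninf[of t] by (cases "\<phi> t"; cases "\<psi> t") auto
  have "convex (?E (\<lambda>x. \<phi> x + \<psi> x))"
  proof (rule convexI, clarsimp)
    fix t1 r1 t2 r2 and u v :: real
    assume uv: "0 \<le> u" "0 \<le> v" "u + v = 1"
      and le: "\<phi> t1 + \<psi> t1 \<le> ereal r1" "\<phi> t2 + \<psi> t2 \<le> ereal r2"
    obtain a1 b1 a2 b2 where 1: "\<phi> t1 = ereal a1" "\<psi> t1 = ereal b1" "a1 + b1 \<le> r1"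
      and 2: "\<phi> t2 = ereal a2" "\<psi> t2 = ereal b2" "a2 + b2 \<le> r2"
      using split le by meson
    have "\<phi> (u *\<^sub>R t1 + v *\<^sub>R t2) \<le> ereal (u * a1 + v * a2)"
      "\<psi> (u *\<^sub>R t1 + v *\<^sub>R t2) \<le> ereal (u * b1 + v * b2)"
      using convexD[OF c(1) _ _ uv, of "(t1, a1)" "(t2, a2)"] 1 2
        convexD[OF c(2) _ _ uv, of "(t1, b1)" "(t2, b2)"] by auto
    then have "\<phi> (u *\<^sub>R t1 + v *\<^sub>R t2) + \<psi> (u *\<^sub>R t1 + v *\<^sub>R t2)
        \<le> ereal (u * a1 + v * a2) + ereal (u * b1 + v * b2)"
      by (rule add_mono)
    also have "\<dots> = ereal (u * (a1 + b1) + v * (a2 + b2))"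
      by (simp add: algebra_simps)
    also have "\<dots> \<le> ereal (u * r1 + v * r2)"
      using uv 1 2 by (simp add: add_mono mult_left_mono)
    finally show "\<phi> (u *\<^sub>R t1 + v *\<^sub>R t2) + \<psi> (u *\<^sub>R t1 + v *\<^sub>R t2) \<le> ereal (u * r1 + v * r2)" .
  qed
  moreover have "closed (?E (\<lambda>x. \<phi> x + \<psi> x))"
  proof -
    have "\<phi> t + \<psi> t \<le> ereal r \<longleftrightarrow> (\<forall>a b. \<phi> t \<le> ereal a \<or> \<psi> t \<le> ereal b \<or> a + b \<le> r)" for t r
    proof
      assume "\<phi> t + \<psi> t \<le> ereal r"
      then show "\<forall>a b. \<phi> t \<le> ereal a \<or> \<psi> t \<le> ereal b \<or> a + b \<le> r"
        using split by fastforce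
    next
      assume *: "\<forall>a b. \<phi> t \<le> ereal a \<or> \<psi> t \<le> ereal b \<or> a + b \<le> r"
      show "\<phi> t + \<psi> t \<le> ereal r"
      proof (rule ccontr)
        assume "\<not> \<phi> t + \<psi> t \<le> ereal r"
        then have less: "ereal r < \<phi> t + \<psi> t" by simp
        \<comment> \<open>Finite lower bounds to fall back on when the other summand is infinite and
          can be approximated by arbitrarily large reals.\<close>
        obtain a' b' where ab': "ereal a' < \<phi> t" "ereal b' < \<psi> t"
          using ninf[of t] ereal_dense2[of "-\<infinity>" "\<phi> t"] ereal_dense2[of "-\<infinity>" "\<psi> t"] by auto
        have "\<exists>a b. ereal a < \<phi> t \<and> ereal b < \<psi> t \<and> r < a + b"
        proof (cases "\<phi> t")
          case (real a)
          note a = this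
          show ?thesis
          proof (cases "\<psi> t")
            case (real b)
            \<comment> \<open>Lowering both values by a third of the gap keeps their sum above
              \<open>r\<close>.\<close>
            define d where "d = (a + b - r) / 3"
            have "0 < d" "r < (a - d) + (b - d)"
              using less by (simp_all add: a real d_def field_simps)
            then show ?thesis
              using a real by (intro exI[of _ "a - d"] exI[of _ "b - d"]) simp
          next
            case PInf
            then show ?thesis
              using ab' by (intro exI[of _ a'] exI[of _ "r - a' + 1"]) simp
          qed (use ninf in auto)
        next
          case PInf
          then show ?thesis
            using ab' by (intro exI[of _ "r - b' + 1"] exI[of _ b']) simp
        qed (use ninf in auto)
        with * show False
          by (metis not_le)
      qed
    qed
    then have "?E (\<lambda>x. \<phi> x + \<psi> x)
        = (\<Inter>a. \<Inter>b. (fst -` {t. \<phi> t \<le> ereal a} \<union> fst -` {t. \<psi> t \<le> ereal b}) \<union> {q. a + b \<le> snd q})"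
      by (simp add: set_eq_iff split_paired_all)
    moreover have sublevel: "closed {t. \<phi> t \<le> ereal a}" "closed {t. \<psi> t \<le> ereal a}" for a
      using closed_vimage[OF c(3), of "\<lambda>t. (t, a)"] closed_vimage[OF c(4), of "\<lambda>t. (t, a)"]
      by (simp_all add: vimage_def continuous_on_Pair)
    ultimately show ?thesis
      by (simp only:) (intro closed_INT ballI closed_Un closed_vimage_fst sublevel
          closed_Collect_le[of "\<lambda>_. _ + _" snd] continuous_intros)
  qed
  ultimately show ?thesis
    using ninf by (simp add: closed_convex_fun_def)
qed

lemma closed_convex_fun_ereal:
  fixes f :: "'a::euclidean_space \<Rightarrow> real"
  assumes "convex_on UNIV f" "continuous_on UNIV f"
  shows "closed_convex_fun UNIV (\<lambda>x. ereal (f x))"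
proof -
  have "{(t, r). f t \<le> r} = epigraph UNIV f"
    by (auto simp: epigraph_def)
  moreover have "closed {q. f (fst q) \<le> snd q}"
    by (intro closed_Collect_le continuous_intros continuous_on_compose2[OF assms(2)]) auto
  ultimately show ?thesis
    using assms(1) by (simp add: closed_convex_fun_def convex_epigraph case_prod_beta')
qed

lemma closed_convex_fun_sum:
  fixes \<phi> :: "'i \<Rightarrow> 'a::euclidean_space \<Rightarrow> ereal"
  assumes "\<And>i. i \<in> I \<Longrightarrow> closed_convex_fun UNIV (\<phi> i)"
  shows "closed_convex_fun UNIV (\<lambda>x. \<Sum>i\<in>I. \<phi> i x)"
  using assms
proof (induction I rule: infinite_finite_induct)
  case (insert i I)
  then show ?case
    by (simp add: closed_convex_fun_add)
qed (use closed_convex_fun_ereal[of "\<lambda>_. 0"] in \<open>simp_all add: zero_ereal_def convex_on_const\<close>)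

lemma block_separable_imp_closed_convex_fun:
  assumes "block_separable_closed_convex blk \<Psi>"
  shows "closed_convex_fun UNIV \<Psi>"
proof -
  obtain \<psi> where \<psi>: "\<And>i. closed_convex_fun (block_space blk i) (\<psi> i)"
    "\<Psi> = (\<lambda>x. \<Sum>i\<in>UNIV. \<psi> i (block blk i x))"
    using assms unfolding block_separable_closed_convex_def by blast
  show ?thesis
    unfolding \<psi>(2)
    by (intro closed_convex_fun_sum closed_convex_fun_comp_linear[OF \<psi>(1)] linear_block
        block_in_block_space)
qed

text \<open>Riesz representation in coordinates: the gradient has the values of the derivative on
  the basis as its coefficients.\<close>

lemma differentiable_imp_GDERIV:
  fixes g :: "'a::euclidean_space \<Rightarrow> real"
  assumes "g differentiable (at u)"
  obtains D where "GDERIV g u :> D"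
proof -
  obtain g' where g': "(g has_derivative g') (at u)"
    using assms by (auto simp: differentiable_def)
  then have lin: "linear g'"
    by (rule has_derivative_linear)
  have "g' h = h \<bullet> (\<Sum>b\<in>Basis. g' b *\<^sub>R b)" for h
  proof -
    have "g' h = g' (\<Sum>b\<in>Basis. (h \<bullet> b) *\<^sub>R b)"
      by (simp add: euclidean_representation)
    also have "\<dots> = (\<Sum>b\<in>Basis. (h \<bullet> b) * g' b)"
      by (simp add: linear_sum[OF lin] linear_cmul[OF lin])
    finally show ?thesis
      by (simp add: inner_sum_right mult.commute)
  qed
  then have "g' = (\<lambda>h. h \<bullet> (\<Sum>b\<in>Basis. g' b *\<^sub>R b))"
    by (rule ext)
  with g' have "GDERIV g u :> (\<Sum>b\<in>Basis. g' b *\<^sub>R b)"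
    unfolding gderiv_def by metis
  then show ?thesis by (rule that)
qed

text \<open>The point \<open>p\<close> is the proximal point of \<open>y\<close>, the minimizer of \<open>\<phi> z + n / 2 * \<parallel>z - y\<parallel>\<^sup>2\<close>,
  for large \<open>n\<close>, and \<open>v = n (y - p)\<close>.\<close>

lemma approximate_subgradient:
  fixes \<phi> :: "'a::euclidean_space \<Rightarrow> ereal"
  assumes \<phi>: "closed_convex_fun UNIV \<phi>" and y: "\<phi> y < \<infinity>" and s: "subgradient \<phi> u s"
    and \<delta>: "0 < \<delta>"
  obtains p v where "subgradient \<phi> p v" "norm (p - y) < \<delta>" "0 \<le> v \<bullet> (y - p)"
proof -
  let ?E = "{(t, r). \<phi> t \<le> ereal r}"
  have ninf: "\<And>t. \<phi> t \<noteq> -\<infinity>" and conv: "convex ?E" and closed: "closed ?E"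
    using \<phi> by (auto simp: closed_convex_fun_def)
  obtain Y where Y: "\<phi> y = ereal Y"
    using y ninf by (cases "\<phi> y") auto
  obtain a where a: "\<phi> u = ereal a"
    using s ninf[of u] by (cases "\<phi> u") (auto simp: subgradient_def effective_dom_def)
  \<comment> \<open>The given subgradient serves only to supply the affine minorant
    \<open>c + s \<bullet> z\<close> of \<phi>, which makes the proximal objective coercive.\<close>
  define c where "c = a - s \<bullet> u"
  have minor: "c + s \<bullet> z \<le> r" if "\<phi> z \<le> ereal r" for z r
  proof -
    have "ereal (c + s \<bullet> z) \<le> \<phi> z"
      using s by (simp add: subgradient_def a c_def inner_diff_right add_diff_eq diff_add_eq)
    also note that
    finally show ?thesis by simp
  qed
  \<comment> \<open>For t whose objective is at most \<open>Y\<close>, put e = t - y. The minorant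
    and - s e <= s s + n (e e) / 4 absorb half of the quadratic term and leave n (e e) <= M.\<close>
  define M where "M = 4 * (Y - (c + s \<bullet> y) + s \<bullet> s)"
  have M: "0 \<le> M"
    using minor[of y Y] Y by (simp add: M_def)
  \<comment> \<open>Large enough that M / n is below \<delta> squared; the summand 1 gives
    \<open>1 \<le> n\<close>, which the absorption needs.\<close>
  define n where "n = M / \<delta>\<^sup>2 + 1"
  have n: "1 \<le> n" "0 < n"
    using M by (simp_all add: n_def add_nonneg_pos)
  let ?q = "\<lambda>t. n / 2 * ((t - y) \<bullet> (t - y))"
  have bound: "(t - y) \<bullet> (t - y) \<le> M / n" if "\<phi> t \<le> ereal r" "r + ?q t \<le> Y" for t r
  proof -
    let ?e = "t - y"
    have "(s + (1/2) *\<^sub>R e) \<bullet> (s + (1/2) *\<^sub>R e) = s \<bullet> s + s \<bullet> e + (e \<bullet> e) / 4" for e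
      by (simp add: inner_add_left inner_add_right inner_commute[of e s] field_simps)
    from this[of ?e] have "- (s \<bullet> ?e) \<le> s \<bullet> s + (?e \<bullet> ?e) / 4"
      using inner_ge_zero[of "s + (1/2) *\<^sub>R ?e"] by linarith
    also have "\<dots> \<le> s \<bullet> s + n * (?e \<bullet> ?e) / 4"
      using mult_right_mono[OF n(1), of "?e \<bullet> ?e"] by simp
    finally have "n * (?e \<bullet> ?e) \<le> M"
      using minor[OF that(1)] that(2) by (simp add: M_def inner_diff_right)
    then show ?thesis
      using n by (simp add: field_simps)
  qed
  define R where "R = sqrt (M / n)"
  \<comment> \<open>Minimizing over pairs (t, r) of the epigraph makes the objective continuous and
    real-valued, so compactness of this sublevel set yields a minimizer. Pairs of the epigraph
    outside it have an objective above \<open>Y\<close>.\<close>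
  define S where "S = ?E \<inter> {q. snd q + ?q (fst q) \<le> Y}"
  have dist: "norm (t - y) \<le> R" if "\<phi> t \<le> ereal r" "r + ?q t \<le> Y" for t r
    using bound[OF that] by (simp add: R_def norm_eq_sqrt_inner)
  have S: "S \<subseteq> cball y R \<times> {c + s \<bullet> y - norm s * R..Y}"
  proof
    fix q assume "q \<in> S"
    then obtain t r where q: "q = (t, r)" and tr: "\<phi> t \<le> ereal r" "r + ?q t \<le> Y"
      by (auto simp: S_def)
    note d = dist[OF tr]
    have "- (s \<bullet> (t - y)) \<le> norm s * norm (t - y)"
      using Cauchy_Schwarz_ineq2[of s "t - y"] by linarith
    also have "\<dots> \<le> norm s * R"
      by (intro mult_left_mono d) simp
    finally have "c + s \<bullet> y \<le> r + norm s * R"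
      using minor[OF tr(1)] by (simp add: inner_diff_right)
    moreover have "0 \<le> ?q t"
      using n by simp
    ultimately show "q \<in> cball y R \<times> {c + s \<bullet> y - norm s * R..Y}"
      using d tr(2) by (simp add: q dist_norm norm_minus_commute)
  qed
  have "closed S"
    unfolding S_def by (intro closed_Int closed closed_Collect_le continuous_intros)
  then have "compact ((cball y R \<times> {c + s \<bullet> y - norm s * R..Y}) \<inter> S)"
    by (intro compact_Int_closed compact_Times compact_cball compact_Icc)
  then have "compact S"
    by (simp only: Int_absorb1[OF S])
  moreover have "(y, Y) \<in> S"
    by (simp add: S_def Y)
  ultimately have "\<exists>q\<in>S. \<forall>q'\<in>S. snd q + ?q (fst q) \<le> snd q' + ?q (fst q')"
    by (intro continuous_attains_inf continuous_intros) auto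
  then obtain p r where pr: "(p, r) \<in> S"
    and min: "\<And>q. q \<in> S \<Longrightarrow> r + ?q p \<le> snd q + ?q (fst q)"
    by force
  have p: "\<phi> p \<le> ereal r" "r + ?q p \<le> Y"
    using pr by (auto simp: S_def)
  have "\<phi> p + ereal (?q p) \<le> \<phi> z + ereal (?q z)" for z
  proof (cases "\<phi> z")
    case (real r')
    have "r + ?q p \<le> r' + ?q z"
    proof (cases "(z, r') \<in> S")
      case True
      then show ?thesis using min by force
    next
      case False
      then show ?thesis using p(2) real by (simp add: S_def)
    qed
    moreover have "\<phi> p + ereal (?q p) \<le> ereal r + ereal (?q p)"
      by (rule add_right_mono[OF p(1)])
    ultimately show ?thesis
      using real by (cases "\<phi> p") auto
  qed (use ninf in auto)
  moreover have "GDERIV ?q p :> n *\<^sub>R (p - y)"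
  proof -
    have "(?q has_derivative (\<lambda>h. n / 2 * ((p - y) \<bullet> h + h \<bullet> (p - y)))) (at p)"
      by (auto intro!: derivative_eq_intros)
    moreover have "n / 2 * ((p - y) \<bullet> h + h \<bullet> (p - y)) = h \<bullet> (n *\<^sub>R (p - y))" for h
      by (simp add: inner_commute[of h])
    ultimately show ?thesis
      by (simp only: gderiv_def)
  qed
  moreover have "\<bar>\<phi> p\<bar> \<noteq> \<infinity>"
    using p(1) ninf[of p] by auto
  ultimately have "subgradient \<phi> p (- (n *\<^sub>R (p - y)))"
    by (intro subgradient_of_argmin_add_smooth conv)
  moreover have "norm (p - y) < \<delta>"
  proof -
    have "M < \<delta>\<^sup>2 * n"
      using \<delta> by (simp add: n_def field_simps)
    then have "M / n < \<delta>\<^sup>2"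
      using n by (simp add: field_simps)
    then have "R < \<delta>"
      unfolding R_def using \<delta> by (simp add: real_less_lsqrt M n(2) real_sqrt_less_iff real_less_rsqrt)
    with dist[OF p] show ?thesis by simp
  qed
  moreover have "0 \<le> - (n *\<^sub>R (p - y)) \<bullet> (y - p)"
  proof -
    have "- (n *\<^sub>R (p - y)) \<bullet> (y - p) = n * ((p - y) \<bullet> (p - y))"
      by (simp add: inner_diff_left inner_diff_right algebra_simps)
    then show ?thesis
      using n by simp
  qed
  ultimately show ?thesis
    by (rule that)
qed

section \<open>Linear convergence\<close>

lemma pcdm_model_eq:
  fixes blk :: "'m::finite \<Rightarrow> 'n::finite"
  assumes "\<And>i. block_posdef blk i (B i)" "\<And>i. 0 \<le> L i"
  shows "pcdm_model blk B L \<omega> f f' \<Psi> x h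
    = ereal (f x + f' x \<bullet> h + real \<omega> / 2 * (weighted_norm blk B L h)\<^sup>2) + \<Psi> (x + h)"
  by (simp add: pcdm_model_def weighted_norm_power2[OF assms] inner_scaleR_left)

lemma differentiable_weighted_norm_power2:
  fixes blk :: "'m::finite \<Rightarrow> 'n::finite"
  assumes "\<And>i. block_posdef blk i (B i)" "\<And>i. 0 \<le> w i"
  shows "(\<lambda>z. (weighted_norm blk B w (z - x))\<^sup>2) differentiable (at u)"
proof -
  have sub: "((\<lambda>z. z - x) has_derivative (\<lambda>h. h - 0)) (at u)"
    by (rule has_derivative_diff[OF has_derivative_ident has_derivative_const])
  note d1 = bounded_linear.has_derivative[OF linear_block[unfolded linear_conv_bounded_linear] sub]
  note d2 = bounded_linear.has_derivative[OF matrix_vector_mul_bounded_linear d1]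
  have "(\<lambda>z. (B i *v block blk i (z - x)) \<bullet> block blk i (z - x)) differentiable (at u)" for i
    unfolding differentiable_def by (rule exI, rule has_derivative_inner[OF d2 d1])
  then show ?thesis
    unfolding weighted_norm_power2[OF assms]
    by (intro differentiable_sum ballI differentiable_mult differentiable_const) simp_all
qed

text \<open>A point \<open>y\<close> of the segment may have no subgradient.  Strong convexity is therefore used at
  points \<open>p\<close> approaching \<open>y\<close> with subgradients \<open>v\<close> such that \<open>v \<bullet> (y - p) \<ge> 0\<close>.\<close>

lemma strongly_convex_proximal_bound:
  fixes blk :: "'m::finite \<Rightarrow> 'n::finite"
  assumes B: "\<And>i. block_posdef blk i (B i)" and w: "\<And>i. 0 \<le> w i"
    and \<phi>: "closed_convex_fun UNIV \<phi>"
    and \<mu>: "strong_convexity_parameter blk B w \<phi> \<mu>" "0 < \<mu>"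
    and s: "subgradient \<phi> u s" and c: "0 \<le> c"
    and x: "\<phi> x = ereal a" and z: "\<phi> z = ereal b"
    and v: "\<And>p. v \<le> \<phi> p + ereal (c / 2 * (weighted_norm blk B w (p - x))\<^sup>2)"
  shows "v \<le> ereal (\<mu> / (c + \<mu>) * b + (1 - \<mu> / (c + \<mu>)) * a)"
proof -
  let ?Q = "\<lambda>h. (weighted_norm blk B w h)\<^sup>2"
  \<comment> \<open>Chosen so that \<open>(c + \<mu>) * l = \<mu>\<close>, which cancels all
    quadratic terms at the end.\<close>
  define l where "l = \<mu> / (c + \<mu>)"
  have l: "0 \<le> l" "l \<le> 1" "(c + \<mu>) * l = \<mu>"
    using c \<mu>(2) by (auto simp: l_def field_simps)
  have ninf: "\<And>t. \<phi> t \<noteq> -\<infinity>"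
    using \<phi> by (simp add: closed_convex_fun_def)
  define y where "y = l *\<^sub>R z + (1 - l) *\<^sub>R x"
  have "(y, l * b + (1 - l) * a) \<in> {(t, r). \<phi> t \<le> ereal r}"
    using convexD[of "{(t, r). \<phi> t \<le> ereal r}" "(z, b)" "(x, a)" l "1 - l"] \<phi> l x z
    by (simp add: y_def closed_convex_fun_def)
  then have y: "\<phi> y < \<infinity>"
    by auto
  \<comment> \<open>The upper bound for \<phi> p + c / 2 * \<open>?Q (p - x)\<close> from averaging
    strong convexity at p towards \<open>z\<close> and \<open>x\<close>. It is free of \<phi> and
    continuous in p, so p can tend to \<open>y\<close>.\<close>
  define H where "H p = l * b + (1 - l) * a - \<mu> / 2 * (l * ?Q (z - p) + (1 - l) * ?Q (x - p))
    + c / 2 * ?Q (p - x)" for p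
  have "\<exists>p. norm (p - y) < 1 / real (Suc n) \<and> v \<le> ereal (H p)" for n
  proof -
    obtain p g where g: "subgradient \<phi> p g" and p: "norm (p - y) < 1 / real (Suc n)"
      and gy: "0 \<le> g \<bullet> (y - p)"
      using approximate_subgradient[OF \<phi> y s, of "1 / real (Suc n)"] by auto
    have dom: "p \<in> effective_dom \<phi>" "x \<in> effective_dom \<phi>" "z \<in> effective_dom \<phi>"
      using g x z by (auto simp: subgradient_def effective_dom_def)
    then obtain d where d: "\<phi> p = ereal d"
      using ninf[of p] by (cases "\<phi> p") (auto simp: effective_dom_def)
    have "d + g \<bullet> (x - p) + \<mu> / 2 * ?Q (x - p) \<le> a" "d + g \<bullet> (z - p) + \<mu> / 2 * ?Q (z - p) \<le> b"
      using \<mu>(1)[unfolded strong_convexity_parameter_def, THEN conjunct2, rule_format, OF dom(1) _ g]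
        dom(2,3) x z by (fastforce simp: d)+
    then have "l * (d + g \<bullet> (z - p) + \<mu> / 2 * ?Q (z - p))
        + (1 - l) * (d + g \<bullet> (x - p) + \<mu> / 2 * ?Q (x - p)) \<le> l * b + (1 - l) * a"
      using l by (intro add_mono mult_left_mono) auto
    moreover have "l * (d + g \<bullet> (z - p) + \<mu> / 2 * ?Q (z - p))
        + (1 - l) * (d + g \<bullet> (x - p) + \<mu> / 2 * ?Q (x - p))
        = d + (l * (g \<bullet> (z - p)) + (1 - l) * (g \<bullet> (x - p)))
          + \<mu> / 2 * (l * ?Q (z - p) + (1 - l) * ?Q (x - p))"
      by (simp add: field_simps)
    moreover have "l * (g \<bullet> (z - p)) + (1 - l) * (g \<bullet> (x - p)) = g \<bullet> (y - p)"
      by (simp add: y_def inner_diff_right inner_add_right algebra_simps)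
    ultimately have "d + c / 2 * ?Q (p - x) \<le> H p"
      unfolding H_def using gy by linarith
    with v[of p] have "v \<le> ereal (H p)"
      by (auto simp: d intro: order_trans)
    with p show ?thesis
      by blast
  qed
  then obtain p where p: "\<And>n. norm (p n - y) < 1 / real (Suc n)" "\<And>n. v \<le> ereal (H (p n))"
    by metis
  have lim: "p \<longlonglongrightarrow> y"
    unfolding LIMSEQ_iff
  proof (intro allI impI)
    fix r :: real assume "0 < r"
    then obtain N where N: "1 / real (Suc N) < r"
      using nat_approx_posE by blast
    show "\<exists>N. \<forall>n\<ge>N. norm (p n - y) < r"
    proof (intro exI allI impI)
      fix n assume "N \<le> n"
      then have "1 / real (Suc n) \<le> 1 / real (Suc N)"
        by (simp add: frac_le)
      with p(1)[of n] N show "norm (p n - y) < r"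
        by linarith
    qed
  qed
  have "continuous_on UNIV H"
    unfolding H_def by (intro continuous_intros)
  from continuous_on_tendsto_compose[OF this lim] have "(\<lambda>n. H (p n)) \<longlonglongrightarrow> H y"
    by simp
  then have "(\<lambda>n. ereal (H (p n))) \<longlonglongrightarrow> ereal (H y)"
    by simp
  then have "v \<le> ereal (H y)"
    by (rule LIMSEQ_le_const) (use p(2) in blast)
  also have "H y = l * b + (1 - l) * a"
  proof -
    have "z - y = (1 - l) *\<^sub>R (z - x)" "x - y = (- l) *\<^sub>R (z - x)" "y - x = l *\<^sub>R (z - x)"
      by (simp_all add: y_def algebra_simps)
    then have "?Q (z - y) = (1 - l)\<^sup>2 * ?Q (z - x)" "?Q (x - y) = l\<^sup>2 * ?Q (z - x)"
      "?Q (y - x) = l\<^sup>2 * ?Q (z - x)"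
      by (simp_all only: weighted_norm_power2_scaleR[where B = B and w = w, OF B w] power2_minus)
    then have "H y = l * b + (1 - l) * a
        - \<mu> / 2 * (l * ((1 - l)\<^sup>2 * ?Q (z - x)) + (1 - l) * (l\<^sup>2 * ?Q (z - x)))
        + c / 2 * (l\<^sup>2 * ?Q (z - x))"
      by (simp only: H_def)
    also have "\<dots> = l * b + (1 - l) * a + l / 2 * ?Q (z - x) * ((c + \<mu>) * l - \<mu>)"
      by (simp add: power2_eq_square field_simps)
    finally have "H y = l * b + (1 - l) * a + l / 2 * ?Q (z - x) * ((c + \<mu>) * l - \<mu>)" .
    then show ?thesis
      by (simp add: l(3))
  qed
  finally show ?thesis
    by (simp add: l_def)
qed

theorem theorem12:
  fixes blk :: "'m::finite \<Rightarrow> 'n::finite"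
    and B :: "'n \<Rightarrow> real ^ 'm ^ 'm"
    and L :: "'n \<Rightarrow> real"
    and \<omega> :: nat
    and f :: "real ^ 'm \<Rightarrow> real"
    and f' :: "real ^ 'm \<Rightarrow> real ^ 'm"
    and \<Psi> F :: "real ^ 'm \<Rightarrow> ereal"
    and \<mu>F \<mu>f q :: real
    and Fstar :: ereal
    and x :: "nat \<Rightarrow> real ^ 'm"
  assumes B: "\<And>i. block_posdef blk i (B i)"
    and L: "\<And>i. 0 < L i"
    and \<omega>: "1 \<le> \<omega>"
    and f: "smooth_convex f"
    and f': "\<And>y. GDERIV f y :> f' y"
    and sep: "partially_separable blk \<omega> f"
    and lip: "block_lipschitz_gradient blk B L f'"
    and \<Psi>: "block_separable_closed_convex blk \<Psi>"
    and F: "F = (\<lambda>y. ereal (f y) + \<Psi> y)"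
    and Fstar: "Fstar = (INF y. F y)"
    and \<mu>F: "strong_convexity_parameter blk B L F \<mu>F" "0 < \<mu>F"
    and \<mu>f: "strong_convexity_parameter blk B L (\<lambda>y. ereal (f y)) \<mu>f"
    and q: "q = 1 - \<mu>F / (real \<omega> + \<mu>F - \<mu>f)"
    and x0: "x 0 \<in> effective_dom F"
    and iter: "pcdm_iterates blk B L \<omega> f f' \<Psi> x"
  shows "(\<forall>k. F (x (Suc k)) - Fstar \<le> ereal q * (F (x k) - Fstar)) \<and>
    (\<forall>\<epsilon> k. 0 < \<epsilon> \<and> ereal \<epsilon> < F (x 0) - Fstar \<and>
        real k \<ge> 1 / (1 - q) * ln (real_of_ereal (F (x 0) - Fstar) / \<epsilon>) \<longrightarrow>
        F (x k) - Fstar \<le> ereal \<epsilon>)"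
proof -
  let ?Q = "\<lambda>h. (weighted_norm blk B L h)\<^sup>2"
  let ?model = "pcdm_model blk B L \<omega> f f' \<Psi>"
  have L0: "\<And>i. 0 \<le> L i"
    using L by (simp add: less_imp_le)
  have cc\<Psi>: "closed_convex_fun UNIV \<Psi>"
    by (rule block_separable_imp_closed_convex_fun[OF \<Psi>])
  have conv_f: "convex_on UNIV f" and diff_f: "f differentiable_on UNIV"
    using f by (auto simp: smooth_convex_def)
  have ccf: "closed_convex_fun UNIV (\<lambda>y. ereal (f y))"
    by (rule closed_convex_fun_ereal[OF conv_f differentiable_imp_continuous_on[OF diff_f]])
  have ccF: "closed_convex_fun UNIV F"
    unfolding F by (rule closed_convex_fun_add[OF ccf cc\<Psi>])
  have ninf: "\<Psi> y \<noteq> -\<infinity>" "F y \<noteq> -\<infinity>" for y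
    using cc\<Psi> ccF by (auto simp: closed_convex_fun_def)
  have model: "?model y h = ereal (f y + f' y \<bullet> h + real \<omega> / 2 * ?Q h) + \<Psi> (y + h)" for y h
    by (rule pcdm_model_eq[where B = B and L = L, OF B L0])
  have eso: "f (y + h) \<le> f y + f' y \<bullet> h + real \<omega> / 2 * ?Q h" for y h
    by (rule separable_overapproximation[where B = B and L = L, OF B L0 \<omega> f' sep lip])
  have lower: "f y + f' y \<bullet> (z - y) + \<mu>f / 2 * ?Q (z - y) \<le> f z" for y z
  proof -
    \<comment> \<open>With \<phi> = f and g = - f the sum is constantly 0, so every point is a
      minimizer and Fermat's rule makes \<open>f' y\<close> a subgradient of f.\<close>
    have "GDERIV (\<lambda>z. - f z) y :> - f' y"
      by (rule GDERIV_minus[OF f'])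
    from subgradient_of_argmin_add_smooth[OF _ _ this, of "\<lambda>y. ereal (f y)"]
    have "subgradient (\<lambda>y. ereal (f y)) y (f' y)"
      using ccf by (simp add: closed_convex_fun_def)
    then show ?thesis
      using \<mu>f by (auto simp: strong_convexity_parameter_def effective_dom_def)
  qed
  define c where "c = real \<omega> - \<mu>f"
  \<comment> \<open>The lower and upper quadratic bounds on f, compared at a coordinate vector
    \<open>e\<close> of positive weighted norm, force \<mu>f <= \<omega>.\<close>
  have c: "0 \<le> c"
  proof -
    obtain j :: 'm where True by simp
    define e :: "real ^ 'm" where "e = axis j 1"
    have e: "e \<in> block_space blk (blk j)" "e \<noteq> 0"
      by (auto simp: e_def block_space_def axis_def vec_eq_iff)
    have "0 < L (blk j) * ((B (blk j) *v block blk (blk j) e) \<bullet> block blk (blk j) e)"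
      using L B[of "blk j"] e by (simp add: block_posdef_def block_of_block_space)
    also have "\<dots> \<le> ?Q e"
      unfolding weighted_norm_power2[where B = B and w = L, OF B L0]
      by (intro member_le_sum mult_nonneg_nonneg L0 block_posdef_nonneg[OF B block_in_block_space])
        auto
    finally have "0 < ?Q e" .
    moreover have "\<mu>f / 2 * ?Q e \<le> real \<omega> / 2 * ?Q e"
      using lower[of 0 e] eso[of 0 e] by simp
    ultimately show ?thesis
      by (simp add: c_def)
  qed
  define l where "l = \<mu>F / (c + \<mu>F)"
  have l: "0 < l" "l \<le> 1" and ql: "q = 1 - l"
    using c \<mu>F(2) by (auto simp: l_def q c_def algebra_simps)
  obtain h where h: "\<And>k. is_arg_min (?model (x k)) (\<lambda>_. True) (h k)"
    and xS: "\<And>k. x (Suc k) = x k + h k"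
    using iter unfolding pcdm_iterates_def by blast
  have argmin: "?model (x k) (h k) \<le> ?model (x k) (z - x k)" for k z
    using h[of k] by (auto simp: is_arg_min_def not_less)
  have step: "F (x (Suc k)) \<le> F z + ereal (c / 2 * ?Q (z - x k))" for k z
  proof -
    have "F (x (Suc k)) \<le> ?model (x k) (h k)"
      unfolding F model xS using eso[of "x k" "h k"] by (intro add_right_mono) simp
    also have "\<dots> \<le> ?model (x k) (z - x k)"
      by (rule argmin)
    also have "\<dots> = ereal (f (x k) + f' (x k) \<bullet> (z - x k) + real \<omega> / 2 * ?Q (z - x k)) + \<Psi> z"
      by (simp add: model)
    also have "\<dots> \<le> ereal (f z + c / 2 * ?Q (z - x k)) + \<Psi> z"
      using lower[of "x k" z] by (intro add_right_mono) (simp add: c_def algebra_simps diff_divide_distrib)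
    also have "\<dots> = F z + ereal (c / 2 * ?Q (z - x k))"
      using ninf[of z] by (cases "\<Psi> z") (simp_all add: F)
    finally show ?thesis .
  qed
  \<comment> \<open>Taking z = \<open>x k\<close> in \<open>step\<close> makes the quadratic term
    vanish, so finiteness passes to the next iterate.\<close>
  have "F (x k) < \<infinity>" for k
  proof (induction k)
    case 0
    then show ?case using x0 by (simp add: effective_dom_def)
  next
    case (Suc k)
    have "weighted_norm blk B L 0 = 0"
      using weighted_norm_power2_scaleR[where B = B and w = L and a = 0, OF B L0] by simp
    then show ?case
      using le_less_trans[OF step[of k "x k"], of \<infinity>] Suc by simp
  qed
  then have "\<exists>r. F (x k) = ereal r" for k
    using ninf(2)[of "x k"] by (metis ereal_cases less_irrefl)
  then obtain a where a: "\<And>k. F (x k) = ereal (a k)"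
    by metis
  \<comment> \<open>One subgradient somewhere is needed to run the proximal argument. The starting
    point need not have one, but \<open>x 1\<close> minimizes the first model, which is F plus the
    differentiable function \<open>?G\<close>.\<close>
  obtain s where s: "subgradient F (x 1) s"
  proof -
    let ?G = "\<lambda>z. f (x 0) + f' (x 0) \<bullet> (z - x 0) + real \<omega> / 2 * ?Q (z - x 0) - f z"
    have "(\<lambda>z. f' (x 0) \<bullet> (z - x 0)) differentiable (at (x 1))"
      unfolding differentiable_def by (rule exI) (rule derivative_intros)+
    then have "?G differentiable (at (x 1))"
      using diff_f by (intro differentiable_diff differentiable_add differentiable_mult
          differentiable_const differentiable_weighted_norm_power2[where B = B and w = L, OF B L0])
        (simp_all add: differentiable_on_def)
    then obtain D where D: "GDERIV ?G (x 1) :> D"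
      by (rule differentiable_imp_GDERIV)
    have G: "F z + ereal (?G z) = ?model (x 0) (z - x 0)" for z
      using ninf[of z] by (cases "\<Psi> z") (simp_all add: F model)
    have "F (x 1) + ereal (?G (x 1)) \<le> F z + ereal (?G z)" for z
      unfolding G using argmin[of 0 z] xS[of 0] by simp
    from subgradient_of_argmin_add_smooth[OF _ _ D this]
    have "subgradient F (x 1) (- D)"
      using ccF a[of 1] by (simp add: closed_convex_fun_def)
    then show ?thesis by (rule that)
  qed
  have contract: "a (Suc k) \<le> l * b + (1 - l) * a k" if "F z = ereal b" for k z b
    using strongly_convex_proximal_bound[where B = B and w = L and c = c, OF B L0 ccF \<mu>F s c a that,
        of "F (x (Suc k))" k] step
    by (simp add: a l_def)
  \<comment> \<open>\<open>contract\<close> solved for the value at z: a lower bound uniform in z.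
    It makes \<open>Fstar\<close> finite and, multiplied by \<open>l\<close>, is the contraction
    itself.\<close>
  have below: "ereal ((a (Suc k) - (1 - l) * a k) / l) \<le> Fstar" for k
    unfolding Fstar
  proof (rule INF_greatest)
    fix z
    show "ereal ((a (Suc k) - (1 - l) * a k) / l) \<le> F z"
    proof (cases "F z")
      case (real b)
      then show ?thesis
        using contract[OF real, of k] l by (simp add: field_simps)
    qed (use ninf in auto)
  qed
  have above: "Fstar \<le> ereal (a k)" for k
    unfolding Fstar a[symmetric] by (rule INF_lower) simp
  obtain m where m: "Fstar = ereal m"
    using below[of 0] above[of 0] by (cases Fstar) auto
  have rec: "a (Suc k) - m \<le> q * (a k - m)" for k
    using below[of k] l by (simp add: m ql field_simps)
  have q01: "0 \<le> q" "q < 1"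
    using l by (simp_all add: ql)
  have pow: "a k - m \<le> q ^ k * (a 0 - m)" for k
  proof (induction k)
    case (Suc k)
    have "a (Suc k) - m \<le> q * (a k - m)"
      by (rule rec)
    also have "\<dots> \<le> q * (q ^ k * (a 0 - m))"
      by (rule mult_left_mono[OF Suc q01(1)])
    finally show ?case by simp
  qed simp
  have "a k - m \<le> \<epsilon>"
    if \<epsilon>: "0 < \<epsilon>" "\<epsilon> < a 0 - m" and k: "real k \<ge> 1 / (1 - q) * ln ((a 0 - m) / \<epsilon>)" for \<epsilon> k
  proof -
    \<comment> \<open>Uses 1 + u <= exp u at u = - (1 - q), with \<open>0 \<le> q\<close> for the
      monotonicity of the power.\<close>
    have "q ^ k \<le> exp (- (1 - q)) ^ k"
      using q01 exp_ge_add_one_self[of "- (1 - q)"] by (intro power_mono) simp_all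
    also have "\<dots> = exp (- ((1 - q) * real k))"
      by (simp add: exp_of_nat_mult[symmetric] algebra_simps)
    also have "\<dots> \<le> exp (- ln ((a 0 - m) / \<epsilon>))"
      using k q01 by (simp add: field_simps)
    also have "\<dots> = \<epsilon> / (a 0 - m)"
      using \<epsilon> by (simp add: exp_minus)
    finally have "q ^ k * (a 0 - m) \<le> \<epsilon>"
      using \<epsilon> by (simp add: field_simps)
    with pow[of k] show ?thesis
      by simp
  qed
  then show ?thesis
    using rec by (simp add: a m)
qed

end
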